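(* For all positive integers $a,b$, $$f(a,b) \geq b\,C_*(a).$$
   Context: Let $A,B$ be disjoint finite sets. A system $\mathcal{Q}$ of quadruples (4-element subsets) of $V=A\cup B$ is called an $(A,B)$-system if every triple (3-element subset) $T \subset V$ with $|T\cap A| \geq 2$ is contained in one of the members (blocks) of $\mathcal{Q}$. $f(a,b)$ denotes the minimum size of an $(A,B)$-system with $|A|=a$, $|B|=b$ (taken to be $+\infty$ if no such system exists, which can only happen when $a+b=3$). For a system $\mathcal{T}$ of triples on a finite set $A$, its weight $w(\mathcal{T})$ is the number of triples in $\mathcal{T}$ plus one-half of the number of pairs (2-element subsets) of $A$ not contained in any triple of $\mathcal{T}$. $C_*(a)$ denotes the minimum weight of a system of triples on an $a$-element set. *)

theory Defs
  imports Complex_Main "HOL-Library.Ramsey" "HOL-Library.Extended_Real"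
begin

(* nsets V k is the set of k-element subsets of V. *)

definition AB_system :: "'a set \<Rightarrow> 'a set \<Rightarrow> 'a set set \<Rightarrow> bool" where
  "AB_system A B Q \<longleftrightarrow>
     finite A \<and> finite B \<and> A \<inter> B = {} \<and>
     Q \<subseteq> nsets (A \<union> B) 4 \<and>
     (\<forall>T \<in> nsets (A \<union> B) 3. card (T \<inter> A) \<ge> 2 \<longrightarrow> (\<exists>K \<in> Q. T \<subseteq> K))"

(* Only the cardinalities of the ground sets matter, so they are taken inside nat.
   An infimum in enat is a minimum, except that the infimum of the empty set is infinity. *)
definition f_min :: "nat \<Rightarrow> nat \<Rightarrow> enat" where
  "f_min a b =
     Inf {enat (card Q) | (A :: nat set) B Q. card A = a \<and> card B = b \<and> AB_system A B Q}"

definition triple_system :: "'a set \<Rightarrow> 'a set set \<Rightarrow> bool" where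
  "triple_system A \<T> \<longleftrightarrow> \<T> \<subseteq> nsets A 3"

definition weight :: "'a set \<Rightarrow> 'a set set \<Rightarrow> real" where
  "weight A \<T> =
     real (card \<T>) + real (card {P \<in> nsets A 2. \<not> (\<exists>T \<in> \<T>. P \<subseteq> T)}) / 2"

(* The real infimum is a minimum, by C_star_attained and C_star_le below. *)
definition C_star :: "nat \<Rightarrow> real" where
  "C_star a =
     Inf {weight A \<T> | (A :: nat set) \<T>. finite A \<and> card A = a \<and> triple_system A \<T>}"

lemma weight_nonneg: "weight A \<T> \<ge> 0"
  by (simp add: weight_def)

lemma C_star_le:
  fixes A :: "nat set"
  assumes "finite A" "card A = a" "triple_system A \<T>"
  shows "C_star a \<le> weight A \<T>"
  unfolding C_star_def
proof (rule cInf_lower)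
  show "bdd_below {weight A \<T> | (A :: nat set) \<T>. finite A \<and> card A = a \<and> triple_system A \<T>}"
    by (rule bdd_belowI[of _ 0]) (auto simp: weight_nonneg)
qed (use assms in blast)

lemma C_star_attained:
  "\<exists>(A :: nat set) \<T>. finite A \<and> card A = a \<and> triple_system A \<T> \<and> weight A \<T> = C_star a"
proof -
  define W where
    "W = {weight A \<T> | (A :: nat set) \<T>. finite A \<and> card A = a \<and> triple_system A \<T>}"
  define h :: "nat \<times> nat \<Rightarrow> real" where "h = (\<lambda>(m, n). real m + real n / 2)"
  have "W \<subseteq> h ` ({..2 ^ a} \<times> {..2 ^ a})"
  proof
    fix x assume "x \<in> W"
    then obtain A :: "nat set" and \<T>
      where A: "finite A" "card A = a" "\<T> \<subseteq> nsets A 3" "x = weight A \<T>"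
      unfolding W_def triple_system_def by blast
    define P where "P = {P \<in> nsets A 2. \<not> (\<exists>T \<in> \<T>. P \<subseteq> T)}"
    have "\<T> \<subseteq> Pow A" "P \<subseteq> Pow A"
      using A(3) unfolding P_def nsets_def by blast+
    then have "card \<T> \<le> card (Pow A)" "card P \<le> card (Pow A)"
      using A(1) by (simp_all add: card_mono)
    then have "(card \<T>, card P) \<in> {..2 ^ a} \<times> {..2 ^ a}"
      using A(1,2) by (simp add: card_Pow)
    moreover have "x = h (card \<T>, card P)"
      by (simp add: A(4) weight_def h_def P_def)
    ultimately show "x \<in> h ` ({..2 ^ a} \<times> {..2 ^ a})"
      by (rule rev_image_eqI)
  qed
  then have fin: "finite W"
    by (rule finite_subset) (intro finite_imageI finite_cartesian_product finite_atMost)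
  have "weight {..<a} {} \<in> W"
    unfolding W_def triple_system_def
    by (intro CollectI exI[of _ "{..<a}"] exI[of _ "{}"] conjI refl) simp_all
  then have "W \<noteq> {}"
    by blast
  with fin have "Inf W \<in> W"
    by (simp add: cInf_eq_Min)
  then have "C_star a \<in> W"
    unfolding C_star_def W_def .
  then show ?thesis
    unfolding W_def by (elim CollectE exE conjE) (intro exI conjI, assumption+, rule sym)
qed

end

theory Submission
  imports Defs
begin

text \<open>
  Fix an \<open>(A, B)\<close>-system \<open>Q\<close>. The idea is to let every block \<open>K\<close> share one unit of charge
  equally among the points of \<open>K \<inter> B\<close>. No charge is created, so the points of \<open>B\<close>
  together receive at most \<open>card Q\<close> (\<open>sum_charge_le_card\<close>). On the other hand, the triples that
  \<open>Q\<close> leaves on \<open>A\<close> around a fixed \<open>x \<in> B\<close>, its link at \<open>x\<close>, form a triple system whose weight is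
  paid for by the charge at \<open>x\<close> (\<open>weight_link_le_charge\<close>): a triple of the link comes from a block
  that gives its whole unit to \<open>x\<close>, and a pair of \<open>A\<close> that the link misses comes from a block with
  two points in \<open>B\<close>, which gives \<open>x\<close> one half. These are precisely the coefficients in the
  weight. So each of the \<open>b\<close> points receives at least the minimum weight.
\<close>

definition link :: "'a set \<Rightarrow> 'a set set \<Rightarrow> 'a \<Rightarrow> 'a set set" where
  "link A Q x = (\<lambda>K. K \<inter> A) ` {K \<in> Q. x \<in> K \<and> card (K \<inter> A) = 3}"

definition charge :: "'a set \<Rightarrow> 'a set set \<Rightarrow> 'a \<Rightarrow> real" where
  "charge B Q x = (\<Sum>K | K \<in> Q \<and> x \<in> K. 1 / real (card (K \<inter> B)))"

lemma AB_system_finite: "AB_system A B Q \<Longrightarrow> finite Q"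
  unfolding AB_system_def nsets_def
  by (metis (no_types, lifting) finite_Pow_iff finite_UnI finite_subset mem_Collect_eq
      PowI subsetI subset_iff)

lemma AB_system_block:
  assumes "AB_system A B Q" "K \<in> Q"
  shows "finite K" and "card (K \<inter> A) + card (K \<inter> B) = 4"
proof -
  from assms have K: "K \<subseteq> A \<union> B" "finite K" "card K = 4" and disj: "A \<inter> B = {}"
    by (auto simp: AB_system_def nsets_def)
  show "finite K" by fact
  have "K = (K \<inter> A) \<union> (K \<inter> B)" using K(1) by blast
  then show "card (K \<inter> A) + card (K \<inter> B) = 4"
    using K(2,3) disj card_Un_disjoint[of "K \<inter> A" "K \<inter> B"] by auto
qed

lemma triple_system_link: "AB_system A B Q \<Longrightarrow> triple_system A (link A Q x)"
  by (auto simp: AB_system_def triple_system_def link_def nsets_def)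

text \<open>
  If the link at \<open>x\<close> misses the pair \<open>P\<close>, the block through \<open>P\<close> and \<open>x\<close> cannot have a third point
  in \<open>A\<close>, since its trace on \<open>A\<close> would then be a triple of the link.
\<close>
lemma uncovered_pair_is_trace:
  assumes Q: "AB_system A B Q" and x: "x \<in> B"
    and P: "P \<in> nsets A 2" and unc: "\<not> (\<exists>T \<in> link A Q x. P \<subseteq> T)"
  shows "\<exists>K \<in> Q. x \<in> K \<and> card (K \<inter> A) = 2 \<and> K \<inter> A = P"
proof -
  have P': "P \<subseteq> A" "finite P" "card P = 2"
    using P by (auto simp: nsets_def)
  have disj: "A \<inter> B = {}"
    using Q by (simp add: AB_system_def)
  then have xA: "x \<notin> A" using x by blast
  then have xP: "x \<notin> P" using P' by blast
  have "insert x P \<in> nsets (A \<union> B) 3"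
    using P' xP x by (auto simp: nsets_def)
  moreover have "insert x P \<inter> A = P"
    using P' xA by blast
  then have "card (insert x P \<inter> A) \<ge> 2"
    using P'(3) by simp
  ultimately obtain K where K: "K \<in> Q" "insert x P \<subseteq> K"
    using Q unfolding AB_system_def by blast
  note block = AB_system_block[OF Q K(1)]
  have "K \<inter> B \<noteq> {}" using K(2) x by blast
  then have "card (K \<inter> B) \<ge> 1"
    using block(1) by (simp add: Suc_le_eq card_gt_0_iff)
  then have "card (K \<inter> A) \<le> 3"
    using block(2) by simp
  moreover have sub: "P \<subseteq> K \<inter> A" using K(2) P'(1) by blast
  then have "card (K \<inter> A) \<ge> 2"
    using card_mono[of "K \<inter> A" P] block(1) P'(3) by simp
  moreover have "card (K \<inter> A) \<noteq> 3"
    using unc K sub unfolding link_def by blast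
  ultimately have card2: "card (K \<inter> A) = 2" by simp
  then have "P = K \<inter> A"
    using card_subset_eq[OF _ sub] block(1) P'(3) by simp
  then show ?thesis using K card2 by blast
qed

lemma weight_link_le_charge:
  assumes Q: "AB_system A B Q" and x: "x \<in> B"
  shows "weight A (link A Q x) \<le> charge B Q x"
proof -
  define S where "S n = {K \<in> Q. x \<in> K \<and> card (K \<inter> A) = n}" for n
  let ?U = "{P \<in> nsets A 2. \<not> (\<exists>T \<in> link A Q x. P \<subseteq> T)}"
  let ?c = "\<lambda>K. 1 / real (card (K \<inter> B))"
  have finQ: "finite Q" by (rule AB_system_finite[OF Q])
  have finS: "finite (S n)" for n
    using finQ by (simp add: S_def)
  have triples: "card (link A Q x) \<le> card (S 3)"
    unfolding link_def S_def[symmetric] by (rule card_image_le[OF finS])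
  have "?U \<subseteq> (\<lambda>K. K \<inter> A) ` S 2"
    using uncovered_pair_is_trace[OF Q x] unfolding S_def by blast
  then have pairs: "card ?U \<le> card (S 2)"
    by (rule surj_card_le[OF finS])
  have "weight A (link A Q x) \<le> real (card (S 3)) + real (card (S 2)) / 2"
    unfolding weight_def using triples pairs by simp
  also have "\<dots> = sum ?c (S 3) + sum ?c (S 2)"
  proof -
    have "card (K \<inter> B) = 4 - n" if "K \<in> S n" for K n
      using that AB_system_block(2)[OF Q, of K] by (auto simp: S_def)
    then have "sum ?c (S n) = (\<Sum>K\<in>S n. 1 / real (4 - n))" for n
      by (intro sum.cong) auto
    then show ?thesis by simp
  qed
  also have "\<dots> = sum ?c (S 3 \<union> S 2)"
    by (rule sum.union_disjoint[symmetric]) (auto simp: finS, auto simp: S_def)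
  also have "\<dots> \<le> charge B Q x"
    unfolding charge_def by (rule sum_mono2) (auto simp: finQ S_def)
  finally show ?thesis .
qed

text \<open>
  Double counting. A block contained in \<open>A\<close> gives nothing away, hence only an inequality.
\<close>
lemma sum_charge_le_card:
  assumes "finite B" "finite Q"
  shows "(\<Sum>x\<in>B. charge B Q x) \<le> real (card Q)"
proof -
  let ?c = "\<lambda>K. 1 / real (card (K \<inter> B))"
  have "(\<Sum>x\<in>B. charge B Q x) = (\<Sum>K\<in>Q. \<Sum>x | x \<in> B \<and> x \<in> K. ?c K)"
    unfolding charge_def using assms by (rule sum.swap_restrict)
  also have "\<dots> = (\<Sum>K\<in>Q. real (card (K \<inter> B)) * ?c K)"
    by (simp add: Collect_conj_eq Int_commute)
  also have "\<dots> \<le> (\<Sum>K\<in>Q. 1)"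
    by (rule sum_mono) simp
  finally show ?thesis by simp
qed

lemma AB_system_card_ge:
  fixes A B :: "nat set"
  assumes Q: "AB_system A B Q"
  shows "real (card B) * C_star (card A) \<le> real (card Q)"
proof -
  have fin: "finite A" "finite B"
    using Q by (auto simp: AB_system_def)
  have "C_star (card A) \<le> charge B Q x" if "x \<in> B" for x
    using C_star_le[OF fin(1) refl triple_system_link[OF Q]] weight_link_le_charge[OF Q that]
    by (rule order_trans)
  then have "real (card B) * C_star (card A) \<le> (\<Sum>x\<in>B. charge B Q x)"
    by (rule sum_bounded_below)
  also have "\<dots> \<le> real (card Q)"
    by (rule sum_charge_le_card[OF fin(2) AB_system_finite[OF Q]])
  finally show ?thesis .
qed

theorem theorem2p3:
  fixes a b :: nat
  assumes "a > 0" and "b > 0"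
  shows "ereal_of_enat (f_min a b) \<ge> ereal (real b * C_star a)"
proof -
  let ?F = "{enat (card Q) | (A :: nat set) B Q. card A = a \<and> card B = b \<and> AB_system A B Q}"
  show ?thesis
  proof (cases "?F = {}")
    case True
    then have "f_min a b = \<infinity>"
      unfolding f_min_def by (simp only: Inf_enat_def) simp
    then show ?thesis by simp
  next
    case False
    \<comment> \<open>The order on \<open>enat\<close> is a well-order, so the infimum is the size of an actual system.\<close>
    then have "f_min a b \<in> ?F"
      unfolding f_min_def by (metis (no_types, lifting) Inf_enat_def LeastI_ex ex_in_conv)
    then obtain A B :: "nat set" and Q
      where "f_min a b = enat (card Q)" "card A = a" "card B = b" "AB_system A B Q"
      by blast
    then show ?thesis using AB_system_card_ge[of A B Q] by simp
  qed
qed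

end
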